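(* Let $G$ be a graph of order $n$ with adjacency matrix $\mathbf{A}$, and consider the binary linear program: maximize $\eta(\mathbf{x})=\sum_{j\in V(G)}x_j$ subject to $(\mathbf{A}+\mathbf{I}_n)\mathbf{x}\le\mathbf{d}$ and $\mathbf{x}\in\{0,1\}^n$, where $\mathbf{I}_n$ is the identity matrix of order $n$ and $\mathbf{d}$ is the vector of vertex degrees of $G$. If $\mathbf{x}^*$ is an optimal solution with components $x^*_j$, then $D^*=\{j\mid x^*_j=0\}$ is a minimum dominating set of $G$ and $\gamma(G)=n-\eta(\mathbf{x}^* )$.
   Context: A dominating set of $G$ is a set $S\subseteq V(G)$ such that every vertex is in $S$ or adjacent to a vertex of $S$; $\gamma(G)$ is the minimum size of a dominating set. *)

theory Defs
  imports "HOL-Analysis.Analysis" "Graph_Theory.Pair_Digraph"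
begin

(* A finite simple graph is a pair_graph: finite vertex set, symmetric irreflexive arc set, so that
   each edge uv is represented by the two arcs (u,v) and (v,u), and the degree of v is its
   out-degree.  For vectors and matrices, the vertex set is all of a finite type, which then
   serves as the index type. *)

definition dominating_set :: "'v pair_pre_digraph \<Rightarrow> 'v set \<Rightarrow> bool" where
  "dominating_set G S \<longleftrightarrow>
     S \<subseteq> pverts G \<and> (\<forall>v\<in>pverts G. v \<in> S \<or> (\<exists>u\<in>S. (v, u) \<in> parcs G))"

definition minimum_dominating_set :: "'v pair_pre_digraph \<Rightarrow> 'v set \<Rightarrow> bool" where
  "minimum_dominating_set G S \<longleftrightarrow> is_arg_min card (dominating_set G) S"

definition domination_number :: "'v pair_pre_digraph \<Rightarrow> nat" where
  "domination_number G = Min (card ` {S. dominating_set G S})"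

definition adjacency_matrix :: "'v::finite pair_pre_digraph \<Rightarrow> real^'v^'v" where
  "adjacency_matrix G = (\<chi> i j. if (i, j) \<in> parcs G then 1 else 0)"

definition degree_vector :: "'v::finite pair_pre_digraph \<Rightarrow> real^'v" where
  "degree_vector G = (\<chi> v. real (out_degree (with_proj G) v))"

definition blp_objective :: "'v::finite pair_pre_digraph \<Rightarrow> real^'v \<Rightarrow> real" where
  "blp_objective G x = (\<Sum>j\<in>pverts G. x $ j)"

(* mat 1 is the identity matrix; the order on vectors is componentwise. *)
definition blp_feasible :: "'v::finite pair_pre_digraph \<Rightarrow> real^'v \<Rightarrow> bool" where
  "blp_feasible G x \<longleftrightarrow>
     (adjacency_matrix G + mat 1) *v x \<le> degree_vector G \<and> (\<forall>j. x $ j \<in> {0, 1})"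

definition blp_optimal :: "'v::finite pair_pre_digraph \<Rightarrow> real^'v \<Rightarrow> bool" where
  "blp_optimal G x \<longleftrightarrow> is_arg_max (blp_objective G) (blp_feasible G) x"

end

theory Submission
  imports Defs
begin

(* The row of (A + I) x \<le> d at a vertex i sums x over the closed neighbourhood of i, which has
   one vertex more than the degree of i.  For binary x the row therefore says exactly that some
   vertex of the closed neighbourhood has x = 0, so feasible points are the complements of the
   indicator vectors of dominating sets, and the objective is n minus the size of the set. *)

definition closed_neighborhood :: "'v pair_pre_digraph \<Rightarrow> 'v \<Rightarrow> 'v set" where
  "closed_neighborhood G v = insert v {u. (v, u) \<in> parcs G}"

text \<open>The library degree counts arcs; the arcs leaving \<open>v\<close> are the pairs with
  first component \<open>v\<close>, so the injection \<open>Pair v\<close> turns the count into one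
  of neighbours.\<close>

lemma out_degree_eq_card_successors:
  "out_degree (with_proj G) v = card {u. (v, u) \<in> parcs G}"
proof -
  have "out_arcs (with_proj G) v = Pair v ` {u. (v, u) \<in> parcs G}"
    by (auto simp: out_arcs_def)
  then show ?thesis
    by (simp add: out_degree_def card_image inj_on_def)
qed

lemma loopfree_pair_graph:
  assumes "pair_graph G"
  shows "(v, v) \<notin> parcs G"
proof -
  interpret pair_graph G by fact
  show ?thesis using no_loops' by auto
qed

text \<open>Without a loop at \<open>v\<close> the diagonal entry of the sum comes from
  \<open>mat 1\<close> alone and is 1 rather than 2, so row \<open>v\<close> is the 0/1 indicator of
  the closed neighbourhood.\<close>

lemma adjacency_plus_identity_row:
  fixes G :: "'v::finite pair_pre_digraph"
  assumes "(v, v) \<notin> parcs G"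
  shows "((adjacency_matrix G + mat 1) *v x) $ v = (\<Sum>j\<in>closed_neighborhood G v. x $ j)"
proof -
  have "((adjacency_matrix G + mat 1) *v x) $ v =
      (\<Sum>j\<in>UNIV. if j \<in> closed_neighborhood G v then x $ j else 0)"
    unfolding matrix_vector_mult_def adjacency_matrix_def mat_def closed_neighborhood_def
    using assms by (auto intro!: sum.cong)
  then show ?thesis
    by (simp add: sum.If_cases)
qed

lemma degree_eq_card_closed_neighborhood:
  fixes G :: "'v::finite pair_pre_digraph"
  assumes "(v, v) \<notin> parcs G"
  shows "degree_vector G $ v = real (card (closed_neighborhood G v)) - 1"
  using assms
  by (simp add: degree_vector_def out_degree_eq_card_successors closed_neighborhood_def)

text \<open>Each summand is 1 minus the indicator of its being zero, so the sum falls short of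
  \<open>card A\<close> by the number of zeros, an integer; a shortfall of at least 1 means that a
  zero exists.\<close>

lemma binary_sum_le_card_minus_1_iff:
  fixes f :: "'a \<Rightarrow> real"
  assumes "finite A" and "\<And>a. a \<in> A \<Longrightarrow> f a \<in> {0, 1}"
  shows "sum f A \<le> real (card A) - 1 \<longleftrightarrow> (\<exists>a\<in>A. f a = 0)"
proof -
  have "sum f A = (\<Sum>a\<in>A. 1 - (if f a = 0 then 1 else 0))"
    using assms(2) by (intro sum.cong) auto
  also have "\<dots> = real (card A) - real (card {a\<in>A. f a = 0})"
    using assms(1) by (simp add: sum_subtractf sum.If_cases Int_def)
  finally have "sum f A \<le> real (card A) - 1 \<longleftrightarrow> card {a\<in>A. f a = 0} \<noteq> 0"
    by auto
  then show ?thesis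
    using assms(1) by auto
qed

lemma blp_feasible_iff_dominating_set:
  fixes G :: "'v::finite pair_pre_digraph"
  assumes "pair_graph G" and "pverts G = UNIV"
  shows "blp_feasible G x \<longleftrightarrow> (\<forall>j. x $ j \<in> {0, 1}) \<and> dominating_set G {j. x $ j = 0}"
proof -
  \<comment> \<open>Binarity has to come first: on a single edge the vector with both entries 1/2
    satisfies the inequality but has no zero entry.\<close>
  have "(adjacency_matrix G + mat 1) *v x \<le> degree_vector G \<longleftrightarrow>
      dominating_set G {j. x $ j = 0}" if binary: "\<forall>j. x $ j \<in> {0, 1}"
  proof -
    have "(adjacency_matrix G + mat 1) *v x \<le> degree_vector G \<longleftrightarrow>
        (\<forall>v. \<exists>j\<in>closed_neighborhood G v. x $ j = 0)"
      unfolding less_eq_vec_def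
      using binary loopfree_pair_graph[OF assms(1)]
      by (simp add: adjacency_plus_identity_row degree_eq_card_closed_neighborhood
          binary_sum_le_card_minus_1_iff)
    also have "\<dots> \<longleftrightarrow> dominating_set G {j. x $ j = 0}"
      using assms(2) by (auto simp: closed_neighborhood_def dominating_set_def)
    finally show ?thesis .
  qed
  then show ?thesis
    unfolding blp_feasible_def by blast
qed

lemma blp_objective_binary:
  fixes G :: "'v::finite pair_pre_digraph"
  assumes "pverts G = UNIV" and "\<forall>j. x $ j \<in> {0, 1}"
  shows "blp_objective G x = real (card (pverts G)) - real (card {j. x $ j = 0})"
proof -
  have "blp_objective G x = (\<Sum>j\<in>UNIV. 1 - (if x $ j = 0 then 1 else 0))"
    unfolding blp_objective_def using assms by (intro sum.cong) auto
  also have "\<dots> = real (card (pverts G)) - real (card {j. x $ j = 0})"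
    using assms(1) by (simp add: sum_subtractf sum.If_cases)
  finally show ?thesis .
qed

text \<open>The size of \<open>S\<close> is attained and is a lower bound; the finite vertex type
  supplies the finiteness that \<open>Min\<close> needs.\<close>

lemma domination_number_eq_card:
  fixes G :: "'v::finite pair_pre_digraph"
  assumes "minimum_dominating_set G S"
  shows "domination_number G = card S"
  unfolding domination_number_def
  using assms unfolding minimum_dominating_set_def is_arg_min_linorder
  by (intro Min_eqI) auto

theorem theorem6:
  fixes G :: "'v::finite pair_pre_digraph" and n :: nat and x :: "real^'v"
  assumes "pair_graph G"
    and "pverts G = UNIV"
    and "n = card (pverts G)"
    and "blp_optimal G x"
  shows "minimum_dominating_set G {j \<in> pverts G. x $ j = 0}
       \<and> real (domination_number G) = real n - blp_objective G x"
proof -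
  let ?D = "{j. x $ j = 0}"
  have optimal: "blp_objective G y \<le> blp_objective G x" if "blp_feasible G y" for y
    using assms(4) that by (auto simp: blp_optimal_def is_arg_max_linorder)
  have binary: "\<forall>j. x $ j \<in> {0, 1}" and dominating: "dominating_set G ?D"
    using assms(4) blp_feasible_iff_dominating_set[OF assms(1,2)]
    by (auto simp: blp_optimal_def is_arg_max_linorder)
  have "card ?D \<le> card S" if "dominating_set G S" for S
  proof -
    \<comment> \<open>The competitor is the indicator of the complement of \<open>S\<close>, chosen
      so that its zero set is \<open>S\<close> and domination by \<open>S\<close> becomes
      feasibility.\<close>
    define y :: "real^'v" where "y = (\<chi> j. if j \<in> S then 0 else 1)"
    have zeros: "{j. y $ j = 0} = S" and y_binary: "\<forall>j. y $ j \<in> {0, 1}"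
      by (auto simp: y_def)
    have "blp_feasible G y"
      using that zeros y_binary blp_feasible_iff_dominating_set[OF assms(1,2)] by simp
    then have "blp_objective G y \<le> blp_objective G x"
      by (rule optimal)
    \<comment> \<open>Both objectives are the order of \<open>G\<close> minus a number of zeros, so
      the inequality between them reverses into one between cardinalities.\<close>
    then show ?thesis
      using blp_objective_binary[OF assms(2) binary] blp_objective_binary[OF assms(2) y_binary]
      by (simp add: zeros)
  qed
  then have "minimum_dominating_set G ?D"
    using dominating by (simp add: minimum_dominating_set_def is_arg_min_linorder)
  then show ?thesis
    using domination_number_eq_card[of G ?D] blp_objective_binary[OF assms(2) binary] assms(2,3)
    by simp
qed

end
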